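(* Let $I=\{i_1,\dots,i_n\}$ be a finite set of non-negative integers, let $V=\langle x^{i_1},\dots,x^{i_n}\rangle\subset\mathbb{C}[x]$, let $m\in\mathbb{Z}$, and let $T$ be a finite-order linear differential operator with polynomial coefficients that is homogeneous of degree $m$. Write $I^{(m)}=\{i\in I \mid i+m\ge 0 \text{ and } i+m\notin I\}=\{\alpha_1,\dots,\alpha_k\}$ (distinct elements; $k=0$ is allowed, with the empty product equal to $1$). Then $T(V)\subset V$ if and only if $$T=\widetilde{T}\cdot(x\partial-\alpha_1)(x\partial-\alpha_2)\cdots(x\partial-\alpha_k)$$ for some finite-order linear differential operator $\widetilde{T}$ with polynomial coefficients that is homogeneous of degree $m$.
   Context: $\partial=d/dx$. All operators act on $\mathbb{C}[x]$ and belong to the algebra of finite-order linear differential operators $\sum_i P_i\partial^i$ with $P_i\in\mathbb{C}[x]$. An operator $T$ is homogeneous of degree $m\in\mathbb{Z}$ if $T(x^i)\in\langle x^{i+m}\rangle$ for all integers $i\ge 0$ (where $\langle x^{j}\rangle$ is read as $0$ for $j<0$); equivalently $T=\sum_{i} c_i x^{i+m}\partial^i$ with $c_i\in\mathbb{C}$ and $c_i=0$ when $i+m<0$. $\langle\cdot\rangle$ denotes complex linear span. *)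

theory Defs
  imports Complex_Main "HOL-Computational_Algebra.Polynomial"
begin

global_interpretation cpoly: vector_space "smult :: complex \<Rightarrow> complex poly \<Rightarrow> complex poly"
  by unfold_locales (simp_all add: smult_add_right smult_add_left)

(* Differential operators are represented by the maps they induce on C[x]; this representation
   is faithful in characteristic 0, and the product of operators is composition. *)
definition diff_op :: "(complex poly \<Rightarrow> complex poly) \<Rightarrow> bool" where
  "diff_op T \<longleftrightarrow>
     (\<exists>(r::nat) (P :: nat \<Rightarrow> complex poly). \<forall>p. T p = (\<Sum>i\<le>r. P i * (pderiv ^^ i) p))"

definition mono_line :: "int \<Rightarrow> complex poly set" where
  "mono_line j = (if j < 0 then {0} else cpoly.span {monom 1 (nat j)})"

definition homogeneous_op :: "int \<Rightarrow> (complex poly \<Rightarrow> complex poly) \<Rightarrow> bool" where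
  "homogeneous_op m T \<longleftrightarrow> (\<forall>i::nat. T (monom 1 i) \<in> mono_line (int i + m))"

definition mono_space :: "nat set \<Rightarrow> complex poly set" where
  "mono_space I = cpoly.span ((\<lambda>i. monom 1 i) ` I)"

definition leaving :: "nat set \<Rightarrow> int \<Rightarrow> nat set" where
  "leaving I m = {i \<in> I. int i + m \<ge> 0 \<and> int i + m \<notin> int ` I}"

definition euler_shift :: "nat \<Rightarrow> complex poly \<Rightarrow> complex poly" where
  "euler_shift a p = [:0, 1:] * pderiv p - smult (of_nat a) p"

(* For [a1, ..., ak] this is (x d/dx - a1) \<circ> ... \<circ> (x d/dx - ak). *)
definition euler_prod :: "nat list \<Rightarrow> complex poly \<Rightarrow> complex poly" where
  "euler_prod as = foldr (\<lambda>a S. euler_shift a \<circ> S) as id"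

end

theory Submission
  imports Defs
begin

text \<open>
  A homogeneous operator of degree \<open>m\<close> acts by \<open>T (x^i) = q(i) x^(i+m)\<close>, where \<open>q\<close> is a
  polynomial vanishing at all \<open>i < -m\<close>; conversely, every such \<open>q\<close> comes from a differential
  operator. The operator leaves the monomial space invariant iff \<open>q\<close> vanishes at every \<open>\<alpha>\<^sub>j\<close>,
  that is, iff \<open>q\<close> is divisible by \<open>\<Prod>(X - \<alpha>\<^sub>j)\<close>, the symbol of \<open>\<Prod>(x\<partial> - \<alpha>\<^sub>j)\<close>. As each
  \<open>\<alpha>\<^sub>j + m \<ge> 0\<close>, the quotient still vanishes at all \<open>i < -m\<close>, so it is again a symbol.
\<close>

text \<open>The factors already split off do not vanish at a new root \<open>a\<close>, since
  \<open>a\<close> differs from all earlier ones; in an integral domain the cofactor must therefore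
  vanish at \<open>a\<close>.\<close>

lemma prod_linear_dvd:
  fixes q :: "'a::idom poly"
  assumes "finite A" and "\<And>a. a \<in> A \<Longrightarrow> poly q a = 0"
  shows "(\<Prod>a\<in>A. [:-a, 1:]) dvd q"
  using assms
proof (induction A rule: finite_induct)
  case (insert a A)
  then obtain r where r: "q = (\<Prod>a\<in>A. [:-a, 1:]) * r"
    by (metis dvdE insertCI)
  have "poly (\<Prod>a\<in>A. [:-a, 1:]) a \<noteq> 0"
    using insert.hyps by (auto simp: poly_prod)
  then have "poly r a = 0"
    using insert.prems[of a] by (simp add: r)
  then have "[:-a, 1:] dvd r"
    by (simp add: poly_eq_0_iff_dvd)
  then show ?case
    unfolding prod.insert[OF insert.hyps] r by (subst mult.commute) (rule mult_dvd_mono[OF dvd_refl])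
qed simp

section \<open>Monomial spaces and linear maps on them\<close>

lemma mono_line_iff: "p \<in> mono_line j \<longleftrightarrow> (\<exists>c. p = (if j < 0 then 0 else monom c (nat j)))"
  by (auto simp: mono_line_def cpoly.span_singleton smult_monom)

text \<open>Replaces spans by a condition on coefficients. Sufficiency follows by writing
  \<open>p\<close> as the sum of its monomials.\<close>

lemma mono_space_iff: "p \<in> mono_space I \<longleftrightarrow> (\<forall>i. i \<notin> I \<longrightarrow> coeff p i = 0)"
proof
  assume "p \<in> mono_space I"
  then show "\<forall>i. i \<notin> I \<longrightarrow> coeff p i = 0"
    unfolding mono_space_def
    by (induction rule: cpoly.span_induct_alt) (auto split: if_splits)
next
  assume p: "\<forall>i. i \<notin> I \<longrightarrow> coeff p i = 0"
  have "monom (coeff p i) i \<in> mono_space I" for i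
  proof (cases "i \<in> I")
    case True
    then have "smult (coeff p i) (monom 1 i) \<in> mono_space I"
      unfolding mono_space_def by (intro cpoly.span_scale cpoly.span_base) auto
    then show ?thesis
      by (simp add: smult_monom)
  next
    case False
    then show ?thesis
      using p by (simp add: mono_space_def cpoly.span_zero)
  qed
  then have "(\<Sum>i\<le>degree p. monom (coeff p i) i) \<in> mono_space I"
    unfolding mono_space_def by (intro cpoly.span_sum)
  then show "p \<in> mono_space I"
    by (simp add: poly_as_sum_of_monoms)
qed

lemma linear_eq_on_monoms:
  assumes "Vector_Spaces.linear smult smult S" and "Vector_Spaces.linear smult smult T"
    and "\<And>i. S (monom 1 i) = T (monom 1 i)"
  shows "S = (T :: complex poly \<Rightarrow> complex poly)"
proof
  fix p
  interpret S: Vector_Spaces.linear smult smult S by fact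
  interpret T: Vector_Spaces.linear smult smult T by fact
  \<comment> \<open>For \<open>UNIV\<close> the coefficient condition is void, so the monomials span
    everything.\<close>
  have "p \<in> cpoly.span (range (monom 1))"
    using mono_space_iff[of p UNIV] by (simp add: mono_space_def)
  then show "S p = T p"
    by (induction rule: cpoly.span_induct_alt)
      (use assms(3) in \<open>auto simp: S.add T.add S.scale T.scale\<close>)
qed

lemma linear_imageI:
  assumes "Vector_Spaces.linear smult smult T" and "\<And>i. i \<in> I \<Longrightarrow> T (monom 1 i) \<in> mono_space J"
  shows "T ` mono_space I \<subseteq> mono_space J"
proof -
  interpret T: Vector_Spaces.linear smult smult T by fact
  have "T p \<in> mono_space J" if "p \<in> mono_space I" for p
    using that unfolding mono_space_def[of I]
    by (induction rule: cpoly.span_induct_alt)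
      (use assms(2) in \<open>auto simp: T.add T.scale mono_space_iff\<close>)
  then show ?thesis
    by blast
qed

lemma linear_polyI:
  assumes "\<And>p q. T (p + q) = T p + T q" and "\<And>c p. T (smult c p) = smult c (T p)"
  shows "Vector_Spaces.linear smult smult (T :: complex poly \<Rightarrow> complex poly)"
  using assms by unfold_locales auto

section \<open>Closure properties of differential operators\<close>

lemma falling_factorial_eq_0: "i < j \<Longrightarrow> (\<Prod>l<j. of_nat i - of_nat l :: complex) = 0"
  by (auto simp: prod_zero_iff)

text \<open>The truncated exponent \<open>i - j\<close> is harmless: for \<open>i < j\<close> the
  falling factorial contains the factor \<open>l = i\<close> and is zero.\<close>

lemma higher_pderiv_monom_prod:
  fixes c :: complex
  shows "(pderiv ^^ j) (monom c i) = monom ((\<Prod>l<j. of_nat i - of_nat l) * c) (i - j)"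
proof (induction j)
  case (Suc j)
  then show ?case
    by (cases "j \<le> i") (simp_all add: pderiv_monom of_nat_diff mult_ac falling_factorial_eq_0)
qed simp

lemma diff_opI: "(\<And>p. T p = (\<Sum>i\<le>r. P i * (pderiv ^^ i) p)) \<Longrightarrow> diff_op T"
  unfolding diff_op_def by blast

lemma diff_op_linear:
  assumes "diff_op T"
  shows "Vector_Spaces.linear smult smult T"
proof -
  from assms obtain r P where T: "\<And>p. T p = (\<Sum>i\<le>r. P i * (pderiv ^^ i) p)"
    unfolding diff_op_def by blast
  show ?thesis
    by (intro linear_polyI)
      (simp_all add: T higher_pderiv_add higher_pderiv_smult distrib_left sum.distrib cpoly.scale_sum_right)
qed

text \<open>Padding with zero coefficients gives any two operators a common order bound, so that
  they can be added termwise.\<close>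

lemma diff_op_pad:
  assumes "diff_op T"
  obtains r P where "\<And>n p. n \<ge> r \<Longrightarrow> T p = (\<Sum>i\<le>n. P i * (pderiv ^^ i) p)"
proof -
  from assms obtain r P where T: "\<And>p. T p = (\<Sum>i\<le>r. P i * (pderiv ^^ i) p)"
    unfolding diff_op_def by blast
  have "T p = (\<Sum>i\<le>n. (if i \<le> r then P i else 0) * (pderiv ^^ i) p)" if "n \<ge> r" for n p
    unfolding T using that by (intro sum.mono_neutral_cong_left) auto
  then show thesis
    by (rule that)
qed

lemma diff_op_add:
  assumes "diff_op S" and "diff_op T"
  shows "diff_op (\<lambda>p. S p + T p)"
proof -
  obtain r P where S: "\<And>n p. n \<ge> r \<Longrightarrow> S p = (\<Sum>i\<le>n. P i * (pderiv ^^ i) p)"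
    using diff_op_pad[OF assms(1)] by blast
  obtain s Q where T: "\<And>n p. n \<ge> s \<Longrightarrow> T p = (\<Sum>i\<le>n. Q i * (pderiv ^^ i) p)"
    using diff_op_pad[OF assms(2)] by blast
  have "S p + T p = (\<Sum>i\<le>max r s. (P i + Q i) * (pderiv ^^ i) p)" for p
    using S[of "max r s"] T[of "max r s"] by (simp add: sum.distrib distrib_right)
  then show ?thesis
    by (rule diff_opI)
qed

lemma diff_op_mult:
  assumes "diff_op T"
  shows "diff_op (\<lambda>p. f * T p)"
proof -
  from assms obtain r P where "\<And>p. T p = (\<Sum>i\<le>r. P i * (pderiv ^^ i) p)"
    unfolding diff_op_def by blast
  then have "f * T p = (\<Sum>i\<le>r. (f * P i) * (pderiv ^^ i) p)" for p
    by (simp add: sum_distrib_left mult.assoc)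
  then show ?thesis
    by (rule diff_opI)
qed

lemma diff_op_id: "diff_op (\<lambda>p. p)"
  unfolding diff_op_def by (intro exI[of _ 0] exI[of _ "\<lambda>_. 1"]) simp

lemma diff_op_comp_pderiv:
  assumes "diff_op T"
  shows "diff_op (\<lambda>p. T (pderiv p))"
proof -
  from assms obtain r P where T: "\<And>p. T p = (\<Sum>i\<le>r. P i * (pderiv ^^ i) p)"
    unfolding diff_op_def by blast
  have "T (pderiv p) = (\<Sum>i\<le>Suc r. (case i of 0 \<Rightarrow> 0 | Suc j \<Rightarrow> P j) * (pderiv ^^ i) p)" for p
    unfolding T by (subst sum.atMost_Suc_shift) (simp add: funpow_Suc_right del: funpow.simps)
  then show ?thesis
    by (rule diff_opI)
qed

lemma diff_op_comp_higher_pderiv: "diff_op T \<Longrightarrow> diff_op (\<lambda>p. T ((pderiv ^^ n) p))"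
proof (induction n)
  case (Suc n)
  then show ?case
    using diff_op_comp_pderiv[of "\<lambda>p. T ((pderiv ^^ n) p)"]
    by (simp add: funpow_Suc_right del: funpow.simps)
qed simp

text \<open>Leibniz rule: the derivative falls either on the coefficients, giving \<open>A\<close>,
  or on the argument, giving \<open>B\<close> after \<open>pderiv\<close>.\<close>

lemma diff_op_pderiv:
  assumes "diff_op T"
  shows "diff_op (\<lambda>p. pderiv (T p))"
proof -
  from assms obtain r P where T: "\<And>p. T p = (\<Sum>i\<le>r. P i * (pderiv ^^ i) p)"
    unfolding diff_op_def by blast
  define A where "A p = (\<Sum>i\<le>r. pderiv (P i) * (pderiv ^^ i) p)" for p
  define B where "B p = (\<Sum>i\<le>r. P i * (pderiv ^^ i) p)" for p
  have "diff_op A" "diff_op B"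
    by (rule diff_opI, rule A_def, rule diff_opI, rule B_def)
  then have "diff_op (\<lambda>p. A p + B (pderiv p))"
    by (intro diff_op_add diff_op_comp_pderiv)
  moreover have "pderiv (T p) = A p + B (pderiv p)" for p
    by (simp add: T A_def B_def higher_pderiv_sum[of 1, simplified] pderiv_mult sum.distrib mult.commute
        flip: funpow_swap1)
  ultimately show ?thesis
    by presburger
qed

section \<open>Symbols of homogeneous operators\<close>

text \<open>
  The vanishing condition makes the truncation in \<^term>\<open>nat (int i + m)\<close> harmless.
\<close>
definition has_symbol :: "int \<Rightarrow> complex poly \<Rightarrow> (complex poly \<Rightarrow> complex poly) \<Rightarrow> bool" where
  "has_symbol m q T \<longleftrightarrow>
     (\<forall>i. T (monom 1 i) = monom (poly q (of_nat i)) (nat (int i + m))) \<and>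
     (\<forall>i. int i + m < 0 \<longrightarrow> poly q (of_nat i) = 0)"

lemma has_symbol_homogeneous: "has_symbol m q T \<Longrightarrow> homogeneous_op m T"
  by (auto simp: has_symbol_def homogeneous_op_def mono_line_iff)

lemma homogeneous_has_symbol:
  assumes "diff_op T" and "homogeneous_op m T"
  obtains q where "has_symbol m q T"
proof -
  from assms(1) obtain r P where T: "\<And>p. T p = (\<Sum>i\<le>r. P i * (pderiv ^^ i) p)"
    unfolding diff_op_def by blast
  \<comment> \<open>The only coefficient of \<open>P j\<close> that contributes to the power
    \<open>i + m\<close> in the image of \<open>monom 1 i\<close>; the exponent \<open>j + m\<close>
    does not depend on \<open>i\<close>.\<close>
  define c where "c j = (if int j + m < 0 then 0 else coeff (P j) (nat (int j + m)))" for j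
  define q where "q = (\<Sum>j\<le>r. smult (c j) (\<Prod>l<j. [:- of_nat l, 1:]))"
  have q: "poly q (of_nat i) = (\<Sum>j\<le>r. c j * (\<Prod>l<j. of_nat i - of_nat l))" for i
    by (simp add: q_def poly_sum poly_prod)
  \<comment> \<open>If \<open>j + m < 0\<close>, then \<open>c j = 0\<close>; otherwise
    \<open>j > i\<close>, and the falling factorial vanishes.\<close>
  have vanish: "poly q (of_nat i) = 0" if "int i + m < 0" for i
    unfolding q using that by (intro sum.neutral ballI) (auto simp: c_def)
  have lead: "coeff (T (monom 1 i)) (nat (int i + m)) = poly q (of_nat i)" if "int i + m \<ge> 0" for i
    unfolding T q coeff_sum higher_pderiv_monom_prod
  proof (intro sum.cong refl)
    fix j
    show "coeff (P j * monom ((\<Prod>l<j. of_nat i - of_nat l) * 1) (i - j)) (nat (int i + m)) =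
      c j * (\<Prod>l<j. of_nat i - of_nat l)"
    proof (cases "j \<le> i")
      case True
      then have "nat (int i + m) < i - j \<longleftrightarrow> int j + m < 0"
        and "\<not> int j + m < 0 \<Longrightarrow> nat (int i + m) - (i - j) = nat (int j + m)"
        using that by auto
      then show ?thesis
        by (simp add: c_def mult.commute[of "P j"] coeff_monom_mult)
    next
      case False
      then show ?thesis
        by (simp add: falling_factorial_eq_0)
    qed
  qed
  \<comment> \<open>Homogeneity leaves at most one nonzero coefficient, which \<open>lead\<close>
    has computed.\<close>
  have "T (monom 1 i) = monom (poly q (of_nat i)) (nat (int i + m))" for i
  proof -
    obtain d where "T (monom 1 i) = (if int i + m < 0 then 0 else monom d (nat (int i + m)))"
      using assms(2) by (auto simp: homogeneous_op_def mono_line_iff)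
    then show ?thesis
      using vanish[of i] lead[of i] by (auto split: if_splits)
  qed
  with vanish have "has_symbol m q T"
    by (simp add: has_symbol_def)
  then show thesis ..
qed

text \<open>The operator is \<open>q\<close> evaluated at the Euler operator by Horner's scheme:
  \<open>pCons a q\<close> becomes multiplication by \<open>a\<close> plus x d/dx applied after the
  operator for \<open>q\<close>.\<close>

lemma ex_diff_op_diagonal:
  "\<exists>T. diff_op T \<and> (\<forall>i. T (monom 1 i) = monom (poly q (of_nat i)) i)"
proof (induction q)
  case 0
  show ?case
    using diff_op_mult[OF diff_op_id, of 0] by (intro exI[of _ "\<lambda>p. 0"]) simp
next
  case (pCons a q)
  then obtain T where T: "diff_op T" "\<And>i. T (monom 1 i) = monom (poly q (of_nat i)) i"
    by blast
  have T_0: "T [:1:] = [:poly q 0:]"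
    using T(2)[of 0] by (simp add: monom_0)
  let ?T = "\<lambda>p. [:a:] * p + monom 1 1 * pderiv (T p)"
  have "?T (monom 1 i) = monom (poly (pCons a q) (of_nat i)) i" for i
    by (cases i) (simp_all add: T pderiv_monom smult_monom mult_monom add_monom monom_0 T_0)
  moreover have "diff_op ?T"
    by (intro diff_op_add diff_op_mult diff_op_pderiv diff_op_id T)
  ultimately show ?case
    by blast
qed

text \<open>
  For \<open>m \<ge> 0\<close> the operator is \<open>x\<^sup>m q(x\<partial>)\<close>. For \<open>m = -n < 0\<close>, write \<open>q(X) = X(X-1)\<dots>(X-n+1) s(X)\<close>;
  the operator is \<open>s(x\<partial> + n) \<partial>\<^sup>n\<close>.
\<close>
lemma ex_diff_op_symbol:
  assumes "\<And>i. int i + m < 0 \<Longrightarrow> poly q (of_nat i) = 0"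
  obtains T where "diff_op T" and "has_symbol m q T"
proof (cases "m \<ge> 0")
  case True
  obtain D where D: "diff_op D" "\<And>i. D (monom 1 i) = monom (poly q (of_nat i)) i"
    using ex_diff_op_diagonal by blast
  have "has_symbol m q (\<lambda>p. monom 1 (nat m) * D p)"
    using True by (simp add: has_symbol_def D mult_monom nat_add_distrib add.commute)
  then show thesis
    using that diff_op_mult[OF D(1)] by blast
next
  case False
  define n where "n = nat (- m)"
  have m: "m = - int n"
    using False by (simp add: n_def)
  \<comment> \<open>The naturals below \<open>n\<close> are exactly those with
    \<open>i + m < 0\<close>, hence roots of \<open>q\<close>.\<close>
  have "(\<Prod>a\<in>of_nat ` {..<n}. [:-a, 1:]) dvd q"
    using assms by (intro prod_linear_dvd) (auto simp: m)
  then have "(\<Prod>l<n. [:-of_nat l, 1:]) dvd q"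
    by (subst (asm) prod.reindex) (auto simp: inj_on_def)
  then obtain s where s: "q = (\<Prod>l<n. [:-of_nat l, 1:]) * s"
    by blast
  \<comment> \<open>The shift by \<open>n\<close> compensates for \<open>pderiv ^^ n\<close>, which
    lowers the exponent to \<open>i - n\<close> before \<open>D\<close> acts.\<close>
  obtain D where D: "diff_op D"
      "\<And>i. D (monom 1 i) = monom (poly (pcompose s [:of_nat n, 1:]) (of_nat i)) i"
    using ex_diff_op_diagonal by blast
  interpret D: Vector_Spaces.linear smult smult D
    using diff_op_linear[OF D(1)] .
  have D_monom: "D (monom c i) = monom (c * poly s (of_nat n + of_nat i)) i" for c i
    using D.scale[of c "monom 1 i"] by (simp add: D smult_monom poly_pcompose add.commute)
  have "D ((pderiv ^^ n) (monom 1 i)) = monom (poly q (of_nat i)) (nat (int i + m))" for i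
  proof (cases "n \<le> i")
    case True
    then show ?thesis
      by (simp add: higher_pderiv_monom_prod D_monom m s poly_prod of_nat_diff
          nat_diff_distrib)
  next
    case False
    then show ?thesis
      by (simp add: higher_pderiv_monom_prod D_monom s poly_prod falling_factorial_eq_0)
  qed
  then have "has_symbol m q (\<lambda>p. D ((pderiv ^^ n) p))"
    using assms by (simp add: has_symbol_def)
  then show thesis
    using that diff_op_comp_higher_pderiv[OF D(1)] by blast
qed

section \<open>Products of shifted Euler operators\<close>

lemma euler_shift_linear: "Vector_Spaces.linear smult smult (euler_shift a)"
  by (intro linear_polyI)
    (simp_all add: euler_shift_def pderiv_add pderiv_smult algebra_simps smult_add_right
      smult_diff_right)

lemma euler_prod_linear: "Vector_Spaces.linear smult smult (euler_prod as)"
proof (induction as)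
  case Nil
  show ?case
    by (intro linear_polyI) (simp_all add: euler_prod_def)
next
  case (Cons a as)
  then show ?case
    using Vector_Spaces.linear_compose[OF Cons.IH euler_shift_linear[of a]]
    by (simp add: euler_prod_def comp_def)
qed

lemma euler_shift_monom: "euler_shift a (monom c i) = monom ((of_nat i - of_nat a) * c) i"
proof -
  have "[:0, 1:] * pderiv (monom c i) = monom (of_nat i * c) i"
    by (cases i) (simp_all add: pderiv_monom flip: monom_Suc)
  then show ?thesis
    by (simp add: euler_shift_def smult_monom diff_monom left_diff_distrib)
qed

text \<open>Monomials are common eigenvectors, so the eigenvalues multiply; distinctness turns the
  product along the list into one over its set.\<close>

lemma euler_prod_monom:
  "distinct as \<Longrightarrow>
    euler_prod as (monom c i) = monom ((\<Prod>a\<in>set as. of_nat i - of_nat a) * c) i"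
  by (induction as) (simp_all add: euler_prod_def euler_shift_monom mult.assoc)

lemma comp_euler_prod_monom:
  assumes "Vector_Spaces.linear smult smult T" and "distinct as"
  shows "T (euler_prod as (monom 1 i)) =
    smult (\<Prod>a\<in>set as. of_nat i - of_nat a) (T (monom 1 i))"
proof -
  interpret T: Vector_Spaces.linear smult smult T by fact
  show ?thesis
    using T.scale[of "\<Prod>a\<in>set as. of_nat i - of_nat a" "monom 1 i"]
    by (simp add: euler_prod_monom[OF assms(2)] smult_monom)
qed

section \<open>Invariance of the monomial space\<close>

lemma leaving_not_mem: "i \<in> leaving I m \<Longrightarrow> nat (int i + m) \<notin> I"
  by (force simp: leaving_def)

theorem theorem3p2:
  fixes I :: "nat set" and m :: int
    and T :: "complex poly \<Rightarrow> complex poly" and \<alpha>s :: "nat list"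
  assumes "finite I"
    and "diff_op T" and "homogeneous_op m T"
    and "distinct \<alpha>s" and "set \<alpha>s = leaving I m"
  shows "T ` mono_space I \<subseteq> mono_space I \<longleftrightarrow>
    (\<exists>T'. diff_op T' \<and> homogeneous_op m T' \<and> T = T' \<circ> euler_prod \<alpha>s)"
proof
  assume inv: "T ` mono_space I \<subseteq> mono_space I"
  obtain q where q: "has_symbol m q T"
    using homogeneous_has_symbol assms(2,3) by blast
  \<comment> \<open>The image of \<open>monom 1 a\<close> lies in the space, yet its exponent
    \<open>a + m\<close> is outside \<open>I\<close>; so its coefficient is zero.\<close>
  have root: "poly q (of_nat a) = 0" if "a \<in> set \<alpha>s" for a
  proof -
    have a: "a \<in> leaving I m"
      using that assms(5) by simp
    then have "monom 1 a \<in> mono_space I"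
      by (auto simp: mono_space_iff leaving_def)
    then have "monom (poly q (of_nat a)) (nat (int a + m)) \<in> mono_space I"
      using inv q by (force simp: has_symbol_def)
    then show ?thesis
      using leaving_not_mem[OF a] by (auto simp: mono_space_iff)
  qed
  then have "(\<Prod>a\<in>of_nat ` set \<alpha>s. [:-a, 1:]) dvd q"
    by (intro prod_linear_dvd) auto
  then have "(\<Prod>a\<in>set \<alpha>s. [:-of_nat a, 1:]) dvd q"
    by (subst (asm) prod.reindex) (auto simp: inj_on_def)
  then obtain s where s: "q = (\<Prod>a\<in>set \<alpha>s. [:-of_nat a, 1:]) * s"
    by blast
  \<comment> \<open>No element of \<open>\<alpha>s\<close> is such an \<open>i\<close>, so the
    product is nonzero there and the zero of \<open>q\<close> passes to \<open>s\<close>.\<close>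
  have "poly s (of_nat i) = 0" if "int i + m < 0" for i
  proof -
    have "i \<notin> set \<alpha>s"
      using that assms(5) by (auto simp: leaving_def)
    moreover have "poly q (of_nat i) = 0"
      using q that by (simp add: has_symbol_def)
    ultimately show ?thesis
      by (auto simp: s poly_prod prod_zero_iff)
  qed
  then obtain T' where T': "diff_op T'" "has_symbol m s T'"
    using ex_diff_op_symbol by blast
  have "T = T' \<circ> euler_prod \<alpha>s"
  proof (rule linear_eq_on_monoms)
    show "Vector_Spaces.linear smult smult (T' \<circ> euler_prod \<alpha>s)"
      by (rule Vector_Spaces.linear_compose[OF euler_prod_linear diff_op_linear[OF T'(1)]])
    show "T (monom 1 i) = (T' \<circ> euler_prod \<alpha>s) (monom 1 i)" for i
      using q T'(2) comp_euler_prod_monom[OF diff_op_linear[OF T'(1)] assms(4), of i]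
      by (simp add: has_symbol_def smult_monom s poly_prod)
  qed (intro diff_op_linear assms)
  then show "\<exists>T'. diff_op T' \<and> homogeneous_op m T' \<and> T = T' \<circ> euler_prod \<alpha>s"
    using T' has_symbol_homogeneous by blast
next
  assume "\<exists>T'. diff_op T' \<and> homogeneous_op m T' \<and> T = T' \<circ> euler_prod \<alpha>s"
  then obtain T' where T': "diff_op T'" "homogeneous_op m T'" "T = T' \<circ> euler_prod \<alpha>s"
    by blast
  show "T ` mono_space I \<subseteq> mono_space I"
  proof (rule linear_imageI[OF diff_op_linear[OF assms(2)]])
    fix i assume i: "i \<in> I"
    have T: "T (monom 1 i) = smult (\<Prod>a\<in>set \<alpha>s. of_nat i - of_nat a) (T' (monom 1 i))"
      using comp_euler_prod_monom[OF diff_op_linear[OF T'(1)] assms(4)] by (simp add: T'(3))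
    obtain d where d: "T' (monom 1 i) = (if int i + m < 0 then 0 else monom d (nat (int i + m)))"
      using T'(2) by (auto simp: homogeneous_op_def mono_line_iff)
    show "T (monom 1 i) \<in> mono_space I"
    \<comment> \<open>For \<open>i\<close> in \<open>leaving I m\<close> an Euler factor kills the
      monomial; otherwise its image is zero or has exponent in \<open>I\<close>.\<close>
    proof (cases "i \<in> leaving I m")
      case True
      then have "(\<Prod>a\<in>set \<alpha>s. of_nat i - of_nat a :: complex) = 0"
        by (auto simp: prod_zero_iff simp flip: assms(5))
      then show ?thesis
        by (simp add: T mono_space_iff)
    next
      case False
      with i have "int i + m < 0 \<or> nat (int i + m) \<in> I"
        by (auto simp: leaving_def)
      then show ?thesis
        by (auto simp: T d mono_space_iff)
    qed
  qed
qed

end
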